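(* Let $G$ be a nonempty finite simple ordered graph and let $w$ be a permutation of its vertex set. Then $w\in\mathcal{D}(G)$ if and only if for every vertex $t$ of $G$ the vertex $\lambda_w(t)$ is adjacent in $G$ to some vertex in $\rho_w(t)$.
   Context: **Ordered graphs and edge operations.** An ordered graph is a finite simple graph $G$ together with a linear order $\le$ on its vertex set $V(G)$; $|G|$ is the number of vertices. If the maximal vertex $t$ of $G$ is not isolated, the maximal edge of $G$ is $e=\{s,t\}$, where $s$ is the maximal vertex adjacent to $t$. For $e=\{s,t\}$ with $s<t$: - Deletion: $G-e$ is $G$ with the edge $e$ removed (same vertices, same order). A permutation of $V(G-e)$ is a permutation of $V(G)$. - Simple contraction: $G/e$ is obtained by contracting $e$ to a single vertex $x$ and removing loops and redundant (multiple) edges; $x$ takes the place of $s$ in the order. For a permutation $w$ of $V(G/e)$, $w_{st}$ denotes the permutation of $V(G)$ obtained by writing $w$ in cycle notation and replacing $x$ by the two consecutive letters $s\,t$ in its cycle. - Extraction: $G-[e]$ is obtained by removing $e$ and its two incident vertices $s,t$ (restricted order). For a permutation $w$ of $V(G-[e])$, $w\sqcup(st)$ is the permutation of $V(G)$ equal to $w$ on $V(G)\setminus\{s,t\}$ and exchanging $s$ and $t$. **The set $\mathcal{D}(G)$.** For a nonempty ordered graph $G$ with maximal vertex $t$, the set $\mathcal{D}(G)$ of permutations of $V(G)$ is defined recursively: - If $V(G)=\{s,t\}$ and $s,t$ are adjacent, then $\mathcal{D}(G)=\{(st)\}$. - If $t$ is isolated, then $\mathcal{D}(G)=\emptyset$.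 - If $t$ is not isolated, $|G|\ge 3$, and $e=\{s,t\}$ is the maximal edge, then $$\mathcal{D}(G)=\mathcal{D}(G-e)\cup\{w_{st}: w\in\mathcal{D}(G/e)\}\cup\{w\sqcup(st): w\in\mathcal{D}(G-[e])\}.$$ **The functions $\rho_w$ and $\lambda_w$.** For a permutation $w$ of $V(G)$ and a vertex $t$, set $$\rho_w(t)=\{t,w(t),\dots,w^{k-1}(t)\},$$ where $k$ is the smallest positive integer such that $w^k(t)\le t$, and set $$\lambda_w(t)=w^{-\ell}(t),$$ where $\ell$ is the smallest positive integer such that $w^{-\ell}(t)\le t$. *)

theory Defs
  imports Main "HOL-Combinatorics.Permutations"
begin

text \<open>
  Vertices are elements of a linearly ordered type, and a vertex set carries the restricted order;
  every finite linear order arises in this way up to isomorphism.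
\<close>

record 'a graph =
  verts :: "'a set"
  edges :: "'a set set"

definition ordered_graph :: "'a::linorder graph \<Rightarrow> bool" where
  "ordered_graph G \<longleftrightarrow> finite (verts G) \<and> (\<forall>e \<in> edges G. e \<subseteq> verts G \<and> card e = 2)"

definition adj :: "'a graph \<Rightarrow> 'a \<Rightarrow> 'a \<Rightarrow> bool" where
  "adj G u v \<longleftrightarrow> {u, v} \<in> edges G"

definition isolated :: "'a graph \<Rightarrow> 'a \<Rightarrow> bool" where
  "isolated G v \<longleftrightarrow> \<not> (\<exists>u \<in> verts G. adj G u v)"

text \<open>
  The maximal edge of a graph whose maximal vertex is not isolated is
  \<open>{max_nbr G, max_vert G}\<close>.
\<close>

definition max_vert :: "'a::linorder graph \<Rightarrow> 'a" where
  "max_vert G = Max (verts G)"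

definition max_nbr :: "'a::linorder graph \<Rightarrow> 'a" where
  "max_nbr G = Max {v \<in> verts G. adj G v (max_vert G)}"

definition delete_edge :: "'a graph \<Rightarrow> 'a \<Rightarrow> 'a \<Rightarrow> 'a graph" where
  "delete_edge G s t = \<lparr>verts = verts G, edges = edges G - {{s, t}}\<rparr>"

text \<open>
  The contracted vertex keeps the name, and hence the place in the order, of \<open>s\<close>.
  The edge \<open>{s, t}\<close> becomes the loop \<open>{s}\<close>, which is removed; parallel edges coincide as sets.
\<close>

definition contract_edge :: "'a graph \<Rightarrow> 'a \<Rightarrow> 'a \<Rightarrow> 'a graph" where
  "contract_edge G s t =
    \<lparr>verts = verts G - {t},
     edges = (\<lambda>e. (id(t := s)) ` e) ` edges G - {{s}}\<rparr>"

definition extract_edge :: "'a graph \<Rightarrow> 'a \<Rightarrow> 'a \<Rightarrow> 'a graph" where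
  "extract_edge G s t =
    \<lparr>verts = verts G - {s, t},
     edges = {e \<in> edges G. e \<inter> {s, t} = {}}\<rparr>"

text \<open>
  Permutations of \<open>V\<close> are functions \<open>w\<close> with \<open>w permutes V\<close>, so they fix every point outside \<open>V\<close>.
  Replacing the contracted vertex (named \<open>s\<close>) by the consecutive letters \<open>s t\<close> in its cycle
  makes \<open>s\<close> map to \<open>t\<close> and \<open>t\<close> map to the old image of \<open>s\<close>. If \<open>w\<close> fixes \<open>s\<close>, this gives
  the transposition of \<open>s\<close> and \<open>t\<close>.
\<close>

definition expand :: "'a \<Rightarrow> 'a \<Rightarrow> ('a \<Rightarrow> 'a) \<Rightarrow> 'a \<Rightarrow> 'a" where
  "expand s t w = w(s := t, t := w s)"

definition adjoin_swap :: "'a \<Rightarrow> 'a \<Rightarrow> ('a \<Rightarrow> 'a) \<Rightarrow> 'a \<Rightarrow> 'a" where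
  "adjoin_swap s t w = w(s := t, t := s)"

lemma ordered_graph_finite_edges: "ordered_graph G \<Longrightarrow> finite (edges G)"
  unfolding ordered_graph_def by (meson Pow_iff finite_Pow_iff finite_subset subsetI)

lemma max_vert_in: "ordered_graph G \<Longrightarrow> verts G \<noteq> {} \<Longrightarrow> max_vert G \<in> verts G"
  unfolding ordered_graph_def max_vert_def by (rule Max_in) auto

lemma max_nbr:
  assumes "ordered_graph G" "\<not> isolated G (max_vert G)"
  shows "max_nbr G \<in> verts G" and "{max_nbr G, max_vert G} \<in> edges G"
    and "max_nbr G \<noteq> max_vert G"
proof -
  have "max_nbr G \<in> {v \<in> verts G. adj G v (max_vert G)}"
    unfolding max_nbr_def using assms
    by (intro Max_in) (auto simp: ordered_graph_def isolated_def)
  then show "max_nbr G \<in> verts G" and e: "{max_nbr G, max_vert G} \<in> edges G"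
    by (auto simp: adj_def)
  from e show "max_nbr G \<noteq> max_vert G"
    using assms(1) by (force simp: ordered_graph_def)
qed

text \<open>
  The first guard makes the function total: the value \<open>{}\<close> on an empty graph or on something
  that is not an ordered graph is a dummy.
\<close>

function DD :: "'a::linorder graph \<Rightarrow> ('a \<Rightarrow> 'a) set" where
  "DD G =
    (if \<not> ordered_graph G \<or> verts G = {} then {}
     else if isolated G (max_vert G) then {}
     else let t = max_vert G; s = max_nbr G in
       if verts G = {s, t} then {Transposition.transpose s t}
       else DD (delete_edge G s t)
            \<union> expand s t ` DD (contract_edge G s t)
            \<union> adjoin_swap s t ` DD (extract_edge G s t))"
  by pat_completeness auto
termination
proof (relation "measure (\<lambda>G. card (verts G) + card (edges G))", goal_cases)
  case 1
  show ?case by simp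
next
  case (2 G t s)
  then have "{s, t} \<in> edges G" and "finite (edges G)"
    using max_nbr(2) ordered_graph_finite_edges by auto
  then have "card (edges G - {{s, t}}) < card (edges G)"
    by (intro card_Diff1_less)
  then show ?case by (simp add: delete_edge_def)
next
  case (3 G t s)
  then have fin: "finite (edges G)" "finite (verts G)" and t: "t \<in> verts G"
    using ordered_graph_finite_edges max_vert_in by (auto simp: ordered_graph_def)
  have "card ((\<lambda>e. (id(t := s)) ` e) ` edges G - {{s}})
      \<le> card ((\<lambda>e. (id(t := s)) ` e) ` edges G)"
    using fin by (intro card_mono) auto
  also have "\<dots> \<le> card (edges G)"
    using fin by (intro card_image_le)
  finally show ?case
    using card_Diff1_less[OF fin(2) t] by (simp add: contract_edge_def)
next
  case (4 G t s)
  then have fin: "finite (edges G)" "finite (verts G)" and t: "t \<in> verts G"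
    using ordered_graph_finite_edges max_vert_in by (auto simp: ordered_graph_def)
  have "card (verts G - {s, t}) < card (verts G)"
    using fin t by (intro psubset_card_mono) auto
  moreover have "card {e \<in> edges G. e \<inter> {s, t} = {}} \<le> card (edges G)"
    using fin by (intro card_mono) auto
  ultimately show ?case by (simp add: extract_edge_def)
qed

declare DD.simps [simp del]

text \<open>The recursive calls stay within nonempty ordered graphs, so the guard is never met.\<close>

lemma ordered_graph_delete: "ordered_graph G \<Longrightarrow> ordered_graph (delete_edge G s t)"
  by (simp add: ordered_graph_def delete_edge_def)

lemma ordered_graph_extract: "ordered_graph G \<Longrightarrow> ordered_graph (extract_edge G s t)"
  by (auto simp: ordered_graph_def extract_edge_def)

lemma ordered_graph_contract:
  assumes G: "ordered_graph G" and s: "s \<in> verts G" and st: "s \<noteq> t"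
  shows "ordered_graph (contract_edge G s t)"
proof -
  have "(id(t := s)) ` e \<subseteq> verts G - {t} \<and> card ((id(t := s)) ` e) = 2"
    if e: "e \<in> edges G" and ne: "(id(t := s)) ` e \<noteq> {s}" for e
  proof -
    obtain a b where ab: "e = {a, b}" "a \<noteq> b" "a \<in> verts G" "b \<in> verts G"
      using G e unfolding ordered_graph_def by (metis card_2_iff insert_subset)
    show ?thesis using ab s st ne by (cases "a = t"; cases "b = t") auto
  qed
  then show ?thesis
    using G by (auto simp: ordered_graph_def contract_edge_def)
qed

lemma verts_nonempty:
  assumes "ordered_graph G" "\<not> isolated G (max_vert G)" "verts G \<noteq> {}"
    and "verts G \<noteq> {max_nbr G, max_vert G}"
  shows "verts (delete_edge G (max_nbr G) (max_vert G)) \<noteq> {}"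
    and "verts (contract_edge G (max_nbr G) (max_vert G)) \<noteq> {}"
    and "verts (extract_edge G (max_nbr G) (max_vert G)) \<noteq> {}"
  using assms max_nbr[OF assms(1,2)] max_vert_in[OF assms(1,3)]
  by (auto simp: delete_edge_def contract_edge_def extract_edge_def)

definition rho :: "('a::linorder \<Rightarrow> 'a) \<Rightarrow> 'a \<Rightarrow> 'a set" where
  "rho w t = (\<lambda>i. (w ^^ i) t) ` {..< (LEAST k. 0 < k \<and> (w ^^ k) t \<le> t)}"

definition lambda :: "('a::linorder \<Rightarrow> 'a) \<Rightarrow> 'a \<Rightarrow> 'a" where
  "lambda w t = (inv w ^^ (LEAST l. 0 < l \<and> (inv w ^^ l) t \<le> t)) t"

end

theory Submission
  imports Defs "HOL-Combinatorics.Cycles"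
begin

text \<open>
  By induction along the recursion, \<open>\<D>(G)\<close> is the set of permutations satisfying the adjacency
  condition. At the maximal vertex \<open>t\<close> the condition says that \<open>w\<^sup>-\<^sup>1(t)\<close> is adjacent to \<open>t\<close>, hence
  \<open>w\<^sup>-\<^sup>1(t) \<le> s\<close> for the maximal edge \<open>{s, t}\<close>. If \<open>w\<^sup>-\<^sup>1(t) \<noteq> s\<close>, no vertex can use the edge \<open>{s, t}\<close>
  and the condition is that of \<open>G - e\<close>. If \<open>w\<close> exchanges \<open>s\<close> and \<open>t\<close>, the condition holds at \<open>s\<close>
  and \<open>t\<close> and is that of \<open>G - [e]\<close> at the other vertices. If \<open>w(s) = t\<close> and \<open>w(t) \<noteq> s\<close>, removing
  \<open>t\<close> from its cycle removes \<open>t\<close> from every \<open>\<rho>(u)\<close> with \<open>u \<noteq> t\<close> and keeps \<open>\<lambda>(u)\<close>, and \<open>\<rho>(u)\<close>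
  contains \<open>t\<close> exactly when it contains \<open>s\<close>; so the condition passes to \<open>G / e\<close>. A permutation of
  \<open>V(G / e)\<close> that fixes the contracted vertex violates the condition, so the three cases are
  disjoint.
\<close>

section \<open>Orbit segments that stay above their starting vertex\<close>

text \<open>This segment of the orbit is \<open>rho w u\<close> for a permutation of a finite set,
  and for \<open>inv w\<close> it is the backward walk that ends just before
  \<open>lambda w u\<close>. The inductive form replaces iterates and \<open>LEAST\<close> by rule
  induction.\<close>

inductive reach :: "('a::linorder \<Rightarrow> 'a) \<Rightarrow> 'a \<Rightarrow> 'a \<Rightarrow> bool" for w u where
  start: "reach w u u"
| step: "reach w u v \<Longrightarrow> u < w v \<Longrightarrow> reach w u (w v)"

lemma reach_ge: "reach w u v \<Longrightarrow> u \<le> v"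
  by (induction rule: reach.induct) auto

lemma reach_trans:
  assumes "reach w u v" "reach w v x"
  shows "reach w u x"
  using assms(2)
proof induction
  case start
  show ?case by fact
next
  case (step x)
  then show ?case using reach_ge[OF assms(1)] by (auto intro: reach.step)
qed

lemma reach_iff_funpow:
  "reach w u v \<longleftrightarrow> (\<exists>i. v = (w ^^ i) u \<and> (\<forall>j. 0 < j \<and> j \<le> i \<longrightarrow> u < (w ^^ j) u))"
proof
  assume "reach w u v"
  then show "\<exists>i. v = (w ^^ i) u \<and> (\<forall>j. 0 < j \<and> j \<le> i \<longrightarrow> u < (w ^^ j) u)"
  proof induction
    case start
    show ?case by (rule exI[of _ 0]) auto
  next
    case (step v)
    then obtain i where "v = (w ^^ i) u" "\<forall>j. 0 < j \<and> j \<le> i \<longrightarrow> u < (w ^^ j) u" by blast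
    then show ?case using step(2)
      by (intro exI[of _ "Suc i"]) (auto simp: le_Suc_eq)
  qed
next
  have "\<forall>j. 0 < j \<and> j \<le> i \<longrightarrow> u < (w ^^ j) u \<Longrightarrow> reach w u ((w ^^ i) u)" for i
  proof (induction i)
    case 0
    show ?case by (simp add: start)
  next
    case (Suc i)
    then have "reach w u ((w ^^ i) u)" "u < w ((w ^^ i) u)" by auto
    then show ?case by (simp add: step)
  qed
  then show "\<exists>i. v = (w ^^ i) u \<and> (\<forall>j. 0 < j \<and> j \<le> i \<longrightarrow> u < (w ^^ j) u) \<Longrightarrow> reach w u v"
    by blast
qed

text \<open>Makes the \<open>LEAST\<close> in \<open>rho\<close> and \<open>lambda\<close>
  meaningful: some positive power of \<open>w\<close> is the identity.\<close>

lemma permutes_return: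
  fixes w :: "'a::linorder \<Rightarrow> 'a"
  assumes "w permutes V" "finite V"
  shows "\<exists>k. 0 < k \<and> (w ^^ k) u \<le> u"
proof -
  have "permutation w" using assms permutation_permutes by blast
  then obtain k where "0 < k" "w ^^ k = id" using permutation_is_nilpotent by blast
  then show ?thesis by (intro exI[of _ k]) auto
qed

lemma rho_eq_reach:
  assumes "w permutes V" "finite V"
  shows "rho w u = {v. reach w u v}"
proof -
  define k where "k = (LEAST k. 0 < k \<and> (w ^^ k) u \<le> u)"
  have k: "0 < k" "(w ^^ k) u \<le> u"
    using LeastI_ex[OF permutes_return[OF assms, of u]] unfolding k_def by auto
  \<comment> \<open>By minimality of \<open>k\<close>, no iterate before the first return is
    \<open>\<le> u\<close>. For \<open>i = 0\<close> the right side is vacuous, which accounts for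
    \<open>u\<close> itself.\<close>
  have "i < k \<longleftrightarrow> (\<forall>j. 0 < j \<and> j \<le> i \<longrightarrow> u < (w ^^ j) u)" for i
  proof
    assume "i < k"
    then show "\<forall>j. 0 < j \<and> j \<le> i \<longrightarrow> u < (w ^^ j) u"
      unfolding k_def using not_less_Least by (metis (mono_tags, lifting) le_less_trans not_less)
  next
    assume "\<forall>j. 0 < j \<and> j \<le> i \<longrightarrow> u < (w ^^ j) u"
    then show "i < k" using k by (meson not_less)
  qed
  then show ?thesis
    unfolding rho_def reach_iff_funpow k_def[symmetric] by auto
qed

text \<open>\<open>y\<close> is the last vertex of the backward segment. If it is the iterate with
  index \<open>i\<close>, the first backward iterate not above \<open>u\<close> has index
  \<open>Suc i\<close>.\<close>

lemma lambda_eqI: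
  assumes "reach (inv w) u y" "inv w y \<le> u"
  shows "lambda w u = inv w y"
proof -
  obtain i where i: "y = (inv w ^^ i) u" "\<forall>j. 0 < j \<and> j \<le> i \<longrightarrow> u < (inv w ^^ j) u"
    using assms(1) unfolding reach_iff_funpow by blast
  have "(LEAST l. 0 < l \<and> (inv w ^^ l) u \<le> u) = Suc i"
    using assms(2) i by (intro Least_equality) (auto simp: not_less_eq_eq[symmetric] leD)
  then show ?thesis using i by (simp add: lambda_def)
qed

lemma lambda_cases:
  assumes "w permutes V" "finite V"
  obtains y where "reach (inv w) u y" "lambda w u = inv w y" "inv w y \<le> u"
proof -
  define k where "k = (LEAST k. 0 < k \<and> (inv w ^^ k) u \<le> u)"
  have k: "0 < k" "(inv w ^^ k) u \<le> u"
    using LeastI_ex[OF permutes_return[OF permutes_inv[OF assms(1)] assms(2), of u]]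
    unfolding k_def by auto
  then obtain i where i: "k = Suc i" by (cases k) auto
  have "u < (inv w ^^ j) u" if "0 < j" "j \<le> i" for j
    using not_less_Least[of j "\<lambda>k. 0 < k \<and> (inv w ^^ k) u \<le> u"] that i
    unfolding k_def[symmetric] by auto
  then have "reach (inv w) u ((inv w ^^ i) u)"
    unfolding reach_iff_funpow by blast
  moreover have "inv w ((inv w ^^ i) u) \<le> u" using k i by simp
  ultimately show thesis using that lambda_eqI by blast
qed

lemma lambda_le:
  assumes "w permutes V" "finite V"
  shows "lambda w u \<le> u"
  using lambda_cases[OF assms] by metis

text \<open>A vertex of the segment other than its start can only have been added by
  \<open>step\<close>, so its predecessor lies in the segment too.\<close>

lemma reach_inv:
  assumes "bij w" "reach w u v" "v \<noteq> u"
  shows "reach w u (inv w v)"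
  using assms(2,3) by cases (auto simp: assms(1) bij_is_inj)

text \<open>A walk that starts in a set closed under the map never leaves it, so only the values on
  that set matter.\<close>

lemma reach_cong:
  assumes eq: "\<And>x. x \<in> A \<Longrightarrow> p x = q x" and closed: "\<And>x. x \<in> A \<Longrightarrow> p x \<in> A" and u: "u \<in> A"
  shows "reach p u v \<longleftrightarrow> reach q u v \<and> v \<in> A"
proof
  assume "reach p u v"
  then show "reach q u v \<and> v \<in> A"
    by induction (use assms in \<open>auto intro: reach.intros\<close>)
next
  have "reach p u v \<and> v \<in> A" if "reach q u v"
    using that by induction (use assms in \<open>auto intro: reach.intros\<close>, metis reach.step)
  then show "reach q u v \<and> v \<in> A \<Longrightarrow> reach p u v" by blast
qed

section \<open>Segments and \<open>lambda\<close> after inserting a vertex or a swap\<close>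

text \<open>Inserting \<open>t\<close> right after \<open>s\<close> makes a detour in the walk.
  Since \<open>u < t\<close>, the walk does not stop at \<open>t\<close>, and it comes to
  \<open>t\<close> only from \<open>s\<close>.\<close>

lemma reach_expand:
  assumes fix_t: "w t = t" and inj: "inj w" and st: "s \<noteq> t" and ut: "u < t"
  shows "reach w u v \<longleftrightarrow> reach (expand s t w) u v \<and> v \<noteq> t"
    and "reach (expand s t w) u t \<longleftrightarrow> reach (expand s t w) u s"
proof -
  let ?x = "expand s t w"
  have t: "w v = t \<longleftrightarrow> v = t" for v using fix_t inj by (metis injD)
  have s_t: "reach ?x u t" if "reach ?x u s"
    using reach.step[OF that] ut by (simp add: expand_def st)
  have fwd: "reach ?x u v \<and> v \<noteq> t" if "reach w u v" for v
    using that
  proof induction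
    case start
    then show ?case using ut by (auto intro: reach.start)
  next
    case (step v)
    have "reach ?x u (w v)"
    proof (cases "v = s")
      case True
      then have "reach ?x u t" using s_t step by blast
      from reach.step[OF this] show ?thesis using step True by (simp add: expand_def)
    next
      case False
      then have "?x v = w v" using step by (simp add: expand_def)
      then show ?thesis using reach.step[of ?x u v] step by metis
    qed
    then show ?case using step t by blast
  qed
  \<comment> \<open>The map \<open>w\<close> has no counterpart of standing at \<open>t\<close>, so
    there the invariant records \<open>s\<close> instead: the step out of \<open>t\<close> is the
    step of \<open>w\<close> out of \<open>s\<close>.\<close>
  have bwd: "if v = t then reach w u s else reach w u v" if "reach ?x u v" for v
    using that
  proof induction
    case start
    then show ?case using ut by (auto intro: reach.start)
  next
    case (step v)
    consider "v = t" | "v = s" "v \<noteq> t" | "v \<noteq> s" "v \<noteq> t" by blast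
    then show ?case
    proof cases
      case 1
      then have "reach w u s" "?x v = w s" "u < w s" using step by (auto simp: expand_def)
      then show ?thesis using t st reach.step by metis
    next
      case 2
      then show ?thesis using step by (auto simp: expand_def)
    next
      case 3
      then have "?x v = w v" by (simp add: expand_def)
      then show ?thesis using step 3 t reach.step by metis
    qed
  qed
  show "reach w u v \<longleftrightarrow> reach ?x u v \<and> v \<noteq> t" using fwd bwd by metis
  show "reach ?x u t \<longleftrightarrow> reach ?x u s" using s_t bwd[of t] fwd[of s] by auto
qed


text \<open>Turns insertion into composition, so that composing with the same transposition again
  takes \<open>t\<close> out of the cycle.\<close>

lemma expand_eq_comp: "w t = t \<Longrightarrow> expand s t w = w \<circ> transpose s t"
  by (auto simp: expand_def transpose_def)

lemma expand_permutes:
  assumes "w permutes V - {t}" "s \<in> V" "t \<in> V"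
  shows "expand s t w permutes V"
proof -
  have "w t = t" "w permutes V"
    using assms(1) by (auto simp: permutes_not_in intro: permutes_subset)
  then show ?thesis
    using assms by (simp add: expand_eq_comp permutes_compose permutes_swap_id)
qed

lemma adjoin_swap_eq_expand: "w s = s \<Longrightarrow> adjoin_swap s t w = expand s t w"
  by (simp add: adjoin_swap_def expand_def)

text \<open>The consecutive letters \<open>s\<close>, \<open>t\<close>, \<open>w s\<close> are read
  backwards: in the inverse cycle \<open>t\<close> stands right after \<open>w s\<close>. Thus
  \<open>reach_expand\<close> also applies to backward walks.\<close>

lemma inv_expand:
  assumes "w permutes V - {t}" "s \<noteq> t"
  shows "inv (expand s t w) = expand (w s) t (inv w)"
proof -
  have "bij w" and t: "w t = t"
    using assms(1) by (auto simp: permutes_not_in permutes_bij)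
  then have "w x = t \<longleftrightarrow> x = t" "w x = w y \<longleftrightarrow> x = y" "inv w x = t \<longleftrightarrow> x = t"
    "inv w x = s \<longleftrightarrow> x = w s" "inv w (w x) = x" "w (inv w x) = x" for x y
    by (metis bij_inv_eq_iff)+
  then show ?thesis
    using assms(2) t by (intro inv_unique_comp ext) (auto simp: expand_def)
qed

lemma rho_expand:
  assumes w: "w permutes V - {t}" and V: "finite V" "s \<in> V" "t \<in> V" and st: "s \<noteq> t" and u: "u < t"
  shows "rho w u = rho (expand s t w) u - {t}"
    and "t \<in> rho (expand s t w) u \<longleftrightarrow> s \<in> rho (expand s t w) u"
proof -
  have "w t = t" "inj w"
    using w by (auto simp: permutes_not_in permutes_inj)
  note r = reach_expand[OF this st u]
  have "rho w u = {v. reach w u v}"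
    using rho_eq_reach[OF w] V by simp
  moreover have "rho (expand s t w) u = {v. reach (expand s t w) u v}"
    using rho_eq_reach[OF expand_permutes[OF w]] V by simp
  ultimately show "rho w u = rho (expand s t w) u - {t}"
    and "t \<in> rho (expand s t w) u \<longleftrightarrow> s \<in> rho (expand s t w) u"
    using r by auto
qed

lemma lambda_expand:
  assumes w: "w permutes V - {t}" and V: "finite V" and st: "s \<noteq> t" and u: "u < t"
  shows "lambda w u = lambda (expand s t w) u"
proof -
  let ?x = "expand s t w"
  have "bij w" and t: "w t = t"
    using w by (auto simp: permutes_not_in permutes_bij)
  then have it: "w s \<noteq> t" "inv w t = t" "inj (inv w)" "inv w (w s) = s"
    using st by (metis bij_inv_eq_iff bij_imp_bij_inv bij_is_inj)+
  have ix: "inv ?x = expand (w s) t (inv w)"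
    by (rule inv_expand[OF w st])
  note r = reach_expand[OF it(2,3,1) u, folded ix]
  obtain y where y: "reach (inv w) u y" "lambda w u = inv w y" "inv w y \<le> u"
    using lambda_cases[OF w] V by blast
  have ry: "reach (inv ?x) u y" "y \<noteq> t" using y(1) r by auto
  show ?thesis
  proof (cases "y = w s")
    \<comment> \<open>Backwards from \<open>w s\<close> the expanded cycle meets \<open>t\<close>
      first. As \<open>t\<close> lies above \<open>u\<close>, the walk goes on through
      \<open>t\<close> and still ends at \<open>s\<close>.\<close>
    case True
    then have "reach (inv ?x) u t" using ry(1) r(2) by simp
    moreover have "inv ?x t = inv w y" unfolding ix using True by (simp add: expand_def)
    ultimately show ?thesis using y lambda_eqI by metis
  next
    case False
    then have "inv ?x y = inv w y" unfolding ix using ry(2) by (simp add: expand_def)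
    then show ?thesis using y ry(1) lambda_eqI by metis
  qed
qed

text \<open>Both permutations preserve the complement of \<open>{s, t}\<close> and agree on it, and
  so do their inverses; \<open>reach_cong\<close> applies in both directions of the walk.\<close>

lemma rho_lambda_adjoin_swap:
  assumes w: "w permutes V - {s, t}" and V: "finite V" "s \<in> V" "t \<in> V" and st: "s \<noteq> t"
    and u: "u \<notin> {s, t}"
  shows "rho (adjoin_swap s t w) u = rho w u" and "lambda (adjoin_swap s t w) u = lambda w u"
    and "s \<notin> rho w u" and "t \<notin> rho w u" and "lambda w u \<notin> {s, t}"
proof -
  let ?x = "adjoin_swap s t w"
  have fixed: "w s = s" "w t = t" and bij: "bij w"
    using w by (auto simp: permutes_not_in permutes_bij)
  have w': "w permutes V - {t}" using w by (rule permutes_subset) auto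
  have "inv w s = s" using fixed permutes_inv_eq[OF w, of s s] by simp
  then have eq: "?x = expand s t w" "adjoin_swap s t (inv w) = expand s t (inv w)"
    using fixed(1) by (simp_all only: adjoin_swap_eq_expand)
  have x: "?x permutes V" unfolding eq by (rule expand_permutes[OF w' V(2,3)])
  have ix: "inv ?x = adjoin_swap s t (inv w)"
    unfolding eq inv_expand[OF w' st] fixed ..
  have clos: "w a \<notin> {s, t}" "inv w a \<notin> {s, t}" if "a \<notin> {s, t}" for a
    using that fixed bij by (auto simp: bij_inv_eq_iff) (metis bij_inv_eq_iff)+
  have r: "reach w u v \<longleftrightarrow> reach ?x u v \<and> v \<in> - {s, t}"
    and r': "reach ?x u v \<longleftrightarrow> reach w u v \<and> v \<in> - {s, t}" for v
    using clos u by (intro reach_cong; simp add: adjoin_swap_def)+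
  have i: "reach (inv w) u v \<longleftrightarrow> reach (inv ?x) u v \<and> v \<in> - {s, t}" for v
    using clos(2) u by (intro reach_cong) (simp_all add: ix adjoin_swap_def[of s t "inv w"])
  have rho: "rho w u = {v. reach w u v}" "rho ?x u = {v. reach ?x u v}"
    using rho_eq_reach[OF w] rho_eq_reach[OF x] V by auto
  show "rho ?x u = rho w u" "s \<notin> rho w u" "t \<notin> rho w u"
    unfolding rho using r r' by auto
  obtain y where y: "reach (inv w) u y" "lambda w u = inv w y" "inv w y \<le> u"
    using lambda_cases[OF w] V by blast
  have iy: "reach (inv ?x) u y" and yA: "y \<notin> {s, t}"
    using y(1) i[of y] by blast+
  have "inv ?x y = inv w y"
    unfolding ix using yA by (simp add: adjoin_swap_def)
  then show "lambda ?x u = lambda w u" using lambda_eqI[OF iy] y(2,3) by simp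
  show "lambda w u \<notin> {s, t}" unfolding y(2) using clos(2)[OF yA] .
qed

section \<open>Maximal vertices and fixed points\<close>

lemma rho_max:
  assumes "w permutes V" "finite V" "t \<in> V" "\<And>v. v \<in> V \<Longrightarrow> v \<le> t"
  shows "rho w t = {t}"
proof -
  have "v = t" if "reach w t v" for v
    using that
  proof induction
    case (step v)
    then have "w t \<le> t" using assms by (simp add: permutes_in_image)
    then show ?case using step by auto
  qed simp
  then show ?thesis
    unfolding rho_eq_reach[OF assms(1,2)] using reach.start by blast
qed

lemma lambda_max:
  assumes "w permutes V" "t \<in> V" "\<And>v. v \<in> V \<Longrightarrow> v \<le> t"
  shows "lambda w t = inv w t"
  using assms permutes_in_image[OF permutes_inv[OF assms(1)]]
  by (intro lambda_eqI reach.start) auto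

lemma rho_lambda_fixed:
  assumes "w permutes V" "finite V" "w u = u"
  shows "rho w u = {u}" "lambda w u = u"
proof -
  have "v = u" if "reach w u v" for v
    using that by induction (use assms(3) in auto)
  then show "rho w u = {u}"
    unfolding rho_eq_reach[OF assms(1,2)] using reach.start by blast
  have "inv w u = u" using assms by (metis permutes_inv_eq)
  then show "lambda w u = u" using lambda_eqI[OF reach.start] by (metis order_refl)
qed

section \<open>The adjacency condition under the three edge operations\<close>

definition linked :: "'a::linorder graph \<Rightarrow> ('a \<Rightarrow> 'a) \<Rightarrow> bool" where
  "linked G w \<longleftrightarrow> (\<forall>u \<in> verts G. \<exists>v \<in> rho w u. adj G (lambda w u) v)"

lemma verts_edge_operations [simp]:
  "verts (delete_edge G s t) = verts G"
  "verts (contract_edge G s t) = verts G - {t}"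
  "verts (extract_edge G s t) = verts G - {s, t}"
  by (simp_all add: delete_edge_def contract_edge_def extract_edge_def)

lemma adj_irrefl: "ordered_graph G \<Longrightarrow> \<not> adj G u u"
  by (force simp: adj_def ordered_graph_def)

text \<open>At a fixed point the condition would ask for a loop.\<close>

lemma linked_no_fixpoint:
  assumes "ordered_graph G" "w permutes verts G" "linked G w" "u \<in> verts G"
  shows "w u \<noteq> u"
proof
  assume "w u = u"
  then have "rho w u = {u}" "lambda w u = u"
    using assms rho_lambda_fixed by (auto simp: ordered_graph_def)
  then have "adj G u u" using assms(3,4) by (metis linked_def singletonD)
  then show False using adj_irrefl[OF assms(1)] by blast
qed

lemma rho_ge: "w permutes V \<Longrightarrow> finite V \<Longrightarrow> v \<in> rho w u \<Longrightarrow> u \<le> v"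
  by (auto simp: rho_eq_reach reach_ge)

text \<open>Describes the maximal edge by order properties alone, so that the arguments inside need
  no \<open>Max\<close>.\<close>

locale maximal_edge =
  fixes G :: "'a::linorder graph" and s t :: 'a
  assumes graph: "ordered_graph G"
    and t_in: "t \<in> verts G" and t_max: "v \<in> verts G \<Longrightarrow> v \<le> t"
    and st_adj: "adj G s t" and s_max: "adj G v t \<Longrightarrow> v \<le> s"
begin

lemma fin: "finite (verts G)"
  using graph by (simp add: ordered_graph_def)

lemma adj_verts: "adj G u v \<Longrightarrow> u \<in> verts G \<and> v \<in> verts G"
  using graph by (force simp: ordered_graph_def adj_def)

lemma s_in: "s \<in> verts G" and s_neq: "s \<noteq> t" and s_less: "s < t"
  using adj_verts[OF st_adj] st_adj adj_irrefl[OF graph] t_max[of s] by (auto simp: order_less_le)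

lemma linked_max:
  assumes "w permutes verts G" "linked G w"
  shows "adj G (inv w t) t"
proof -
  have "rho w t = {t}" "lambda w t = inv w t"
    using assms(1) t_in t_max fin rho_max lambda_max by metis+
  then show ?thesis using assms(2) t_in by (auto simp: linked_def)
qed

lemma linked_delete:
  assumes w: "w permutes verts G" and ne: "inv w t \<noteq> s"
  shows "linked (delete_edge G s t) w \<longleftrightarrow> linked G w"
proof
  show "linked (delete_edge G s t) w \<Longrightarrow> linked G w"
    by (auto simp: linked_def delete_edge_def adj_def)
next
  assume L: "linked G w"
  have "adj (delete_edge G s t) (lambda w u) v"
    if u: "u \<in> verts G" "v \<in> rho w u" "adj G (lambda w u) v" for u v
  proof -
    have False if e: "{lambda w u, v} = {s, t}"
    proof (cases "u = t")
      case True
      then have "rho w u = {t}" "lambda w u = inv w t"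
        using w t_in t_max fin rho_max lambda_max by metis+
      then show False using e ne u by (auto simp: doubleton_eq_iff)
    next
      case False
      then have ut: "u < t" using t_max u by (simp add: order_less_le)
      have "lambda w u \<le> u" using lambda_le[OF w fin] .
      \<comment> \<open>Since \<open>lambda w u \<le> u < t\<close>, the edge can be used in this
        orientation only.\<close>
      then have eq: "lambda w u = s" "v = t" using e ut by (auto simp: doubleton_eq_iff)
      then have "reach w u t" using u(2) rho_eq_reach[OF w fin] by auto
      \<comment> \<open>The predecessor of \<open>t\<close> lies in the segment, hence is at least
        \<open>u\<close> and so at least \<open>s\<close>. Being adjacent to \<open>t\<close>, it is
        also at most \<open>s\<close>, which contradicts \<open>ne\<close>.\<close>
      then have "reach w u (inv w t)" using reach_inv w False permutes_bij by metis
      then have "s \<le> inv w t" using reach_ge eq \<open>lambda w u \<le> u\<close> by fastforce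
      then show False using s_max[OF linked_max[OF w L]] ne by simp
    qed
    then show ?thesis using u by (auto simp: delete_edge_def adj_def)
  qed
  then show "linked (delete_edge G s t) w"
    using L by (fastforce simp: linked_def)
qed

lemma adj_contract:
  assumes "a \<noteq> t" "b \<noteq> t"
  shows "adj (contract_edge G s t) a b \<longleftrightarrow>
    a \<noteq> b \<and> (adj G a b \<or> a = s \<and> adj G b t \<or> b = s \<and> adj G a t)"
proof
  assume "adj (contract_edge G s t) a b"
  then obtain e where e: "e \<in> edges G" "{a, b} = (id(t := s)) ` e" "{a, b} \<noteq> {s}"
    by (auto simp: adj_def contract_edge_def)
  obtain c d where cd: "e = {c, d}" "c \<noteq> d"
    using e graph unfolding ordered_graph_def by (metis card_2_iff)
  show "a \<noteq> b \<and> (adj G a b \<or> a = s \<and> adj G b t \<or> b = s \<and> adj G a t)"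
    using e assms cd(2) unfolding cd(1) adj_def
    by (cases "c = t"; cases "d = t") (auto simp: doubleton_eq_iff insert_commute)
next
  assume R: "a \<noteq> b \<and> (adj G a b \<or> a = s \<and> adj G b t \<or> b = s \<and> adj G a t)"
  then obtain e where "e \<in> edges G" "{a, b} = (id(t := s)) ` e"
  proof (elim conjE disjE)
    assume "adj G a b"
    then show thesis using that[of "{a, b}"] assms by (auto simp: adj_def)
  next
    assume "a = s" "adj G b t"
    then show thesis using that[of "{b, t}"] assms by (auto simp: adj_def)
  next
    assume "b = s" "adj G a t"
    then show thesis using that[of "{a, t}"] assms by (auto simp: adj_def)
  qed
  then show "adj (contract_edge G s t) a b"
    using R by (auto simp: adj_def contract_edge_def)
qed

text \<open>The assumption \<open>w s \<noteq> s\<close> separates this case from extraction: if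
  \<open>w\<close> fixes \<open>s\<close>, the condition fails in the contraction but may hold in
  \<open>G\<close>.\<close>

lemma linked_contract:
  assumes w: "w permutes verts G - {t}" and ne: "w s \<noteq> s"
  shows "linked G (expand s t w) \<longleftrightarrow> linked (contract_edge G s t) w"
proof -
  let ?x = "expand s t w"
  have x: "?x permutes verts G" using expand_permutes[OF w s_in t_in] .
  have "?x s = t" using s_neq by (simp add: expand_def)
  then have ixt: "inv ?x t = s" using x by (metis permutes_inv_eq)
  have T: "\<exists>v \<in> rho ?x t. adj G (lambda ?x t) v"
    using rho_max[OF x fin t_in t_max] lambda_max[OF x t_in t_max] st_adj ixt by simp
  have fw: "finite (verts G - {t})" using fin by simp
  note ge = rho_ge[OF w fw] and le = lambda_le[OF w fw]
  have less: "u < t" if "u \<in> verts G - {t}" for u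
    using that t_max by (auto simp: order_less_le)
  note r = rho_expand[OF w fin s_in t_in s_neq less]
    and l = lambda_expand[OF w fin s_neq less]
  have lt: "lambda w u \<noteq> t" if "u \<in> verts G - {t}" for u
    using le[of u] less[OF that] by auto
  \<comment> \<open>The assumption \<open>lus\<close> excludes the one situation in which the
    witnessing edge could be \<open>{s, t}\<close> itself, which contraction turns into a loop and
    removes.\<close>
  have fwd: "\<exists>v \<in> rho w u. adj (contract_edge G s t) (lambda w u) v"
    if u: "u \<in> verts G - {t}" and ex: "\<exists>v \<in> rho ?x u. adj G (lambda ?x u) v"
      and lus: "\<not> (lambda w u = s \<and> s \<in> rho w u)" for u
  proof -
    obtain v where v: "v \<in> rho ?x u" "adj G (lambda w u) v" using ex l[OF u] by auto
    show ?thesis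
    proof (cases "v = t")
      case True
      then have "s \<in> rho w u" using r[OF u] v s_neq by auto
      then show ?thesis using True v lus adj_contract[OF lt[OF u] s_neq] by blast
    next
      case False
      then have "v \<in> rho w u" using r[OF u] v by auto
      moreover have "lambda w u \<noteq> v" using v adj_irrefl[OF graph] by auto
      ultimately show ?thesis using v adj_contract[OF lt[OF u] False] by blast
    qed
  qed
  have bwd: "\<exists>v \<in> rho ?x u. adj G (lambda ?x u) v"
    if u: "u \<in> verts G - {t}"
      and ex: "\<exists>v \<in> rho w u. adj (contract_edge G s t) (lambda w u) v" for u
  proof -
    obtain v where v: "v \<in> rho w u" "adj (contract_edge G s t) (lambda w u) v" using ex by auto
    then have vx: "v \<in> rho ?x u" "v \<noteq> t" using r[OF u] by auto
    have c: "lambda w u \<noteq> v" "adj G (lambda w u) v \<or> lambda w u = s \<and> adj G v t \<or> v = s \<and> adj G (lambda w u) t"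
      using v adj_contract[OF lt[OF u] vx(2)] by auto
    \<comment> \<open>Otherwise \<open>s = lambda w u \<le> u \<le> v\<close>, while maximality of
      \<open>s\<close> among the neighbours of \<open>t\<close> gives \<open>v \<le> s\<close>; then
      \<open>v\<close> would equal \<open>lambda w u\<close>.\<close>
    moreover have "\<not> (lambda w u = s \<and> adj G v t)"
      using s_max[of v] ge[OF v(1)] le[of u] c(1) by auto
    moreover have "v = s \<Longrightarrow> t \<in> rho ?x u" using vx r[OF u] by auto
    ultimately show ?thesis using vx l[OF u] by metis
  qed
  show ?thesis
  proof
    assume "linked (contract_edge G s t) w"
    then show "linked G ?x" using T bwd by (auto simp: linked_def)
  next
    assume L: "linked G ?x"
    have "\<exists>v \<in> rho w u. adj (contract_edge G s t) (lambda w u) v" if u: "u \<in> verts G - {t}" for u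
    proof (cases "lambda w u = s \<and> s \<in> rho w u")
      case False
      then show ?thesis using fwd[OF u] L u by (auto simp: linked_def)
    next
      case True
      \<comment> \<open>The witness in \<open>G\<close> may be the contracted edge itself. As \<open>s\<close> is then minimal in its cycle,
        the condition at \<open>w s\<close>, whose \<open>\<lambda>\<close> is again \<open>s\<close>, provides another witness.\<close>
      then have us: "u = s" using ge[of s u] le[of u] by auto
      obtain y where y: "reach (inv w) s y" "s = inv w y"
        using lambda_cases[OF w fw, of s] True us by metis
      have iws: "inv w (w s) = s" and "w s = y"
        using y(2) permutes_inverses[OF w] by simp_all
      then have ws: "s < w s" using reach_ge[OF y(1)] ne by simp
      have wsV: "w s \<in> verts G - {t}"
        using permutes_in_image[OF w, of s] s_in s_neq by simp
      have ls: "lambda w (w s) = s"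
        using lambda_eqI[OF reach.start, of w "w s"] iws ws by simp
      have "s \<notin> rho w (w s)" using ge[of s "w s"] ws by auto
      then obtain v where v: "v \<in> rho w (w s)" "adj (contract_edge G s t) s v"
        using fwd[OF wsV] L wsV ls by (auto simp: linked_def)
      have "v \<in> rho w s"
        using v(1) reach_trans[of w s "w s" v] reach.step[OF reach.start, of s w] ws
        by (simp add: rho_eq_reach[OF w fw])
      then show ?thesis using v True us by auto
    qed
    then show "linked (contract_edge G s t) w"
      by (auto simp: linked_def)
  qed
qed

lemma linked_extract:
  assumes w: "w permutes verts G - {s, t}"
  shows "linked G (adjoin_swap s t w) \<longleftrightarrow> linked (extract_edge G s t) w"
proof -
  let ?x = "adjoin_swap s t w"
  have fixed: "w s = s" using w by (auto simp: permutes_not_in)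
  have "w permutes verts G - {t}" using w by (rule permutes_subset) auto
  then have x: "?x permutes verts G"
    using expand_permutes s_in t_in fixed by (metis adjoin_swap_eq_expand)
  have xst: "?x s = t" "?x t = s" using s_neq by (auto simp: adjoin_swap_def)
  then have ix: "inv ?x t = s" "inv ?x s = t" using x by (metis permutes_inv_eq)+
  have T: "\<exists>v \<in> rho ?x t. adj G (lambda ?x t) v"
    using rho_max[OF x fin t_in t_max] lambda_max[OF x t_in t_max] st_adj ix by simp
  \<comment> \<open>Backwards from \<open>s\<close> the walk passes through \<open>t > s\<close> and
    returns, so \<open>lambda ?x s = s\<close>; forwards the segment contains \<open>t\<close>. The
    maximal edge itself is therefore the witness at \<open>s\<close>.\<close>
  have "reach (inv ?x) s t"
    using reach.step[OF reach.start, of s "inv ?x"] ix s_less by simp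
  then have "lambda ?x s = s" using lambda_eqI[of ?x s t] ix by simp
  moreover have "t \<in> rho ?x s"
    using reach.step[OF reach.start, of s ?x] xst s_less rho_eq_reach[OF x fin] by simp
  ultimately have S: "\<exists>v \<in> rho ?x s. adj G (lambda ?x s) v" using st_adj by auto
  have fw: "finite (verts G - {s, t})" using fin by simp
  have U: "(\<exists>v \<in> rho ?x u. adj G (lambda ?x u) v) \<longleftrightarrow>
    (\<exists>v \<in> rho w u. adj (extract_edge G s t) (lambda w u) v)" if u: "u \<in> verts G - {s, t}" for u
  proof -
    have st: "u \<notin> {s, t}" using u by auto
    note r = rho_lambda_adjoin_swap[OF w fin s_in t_in s_neq st]
    show ?thesis using r by (auto simp: adj_def extract_edge_def)
  qed
  have "linked G ?x \<longleftrightarrow> (\<forall>u \<in> verts G - {s, t}. \<exists>v \<in> rho ?x u. adj G (lambda ?x u) v)"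
    using T S unfolding linked_def by blast
  then show ?thesis using U by (simp add: linked_def)
qed

end


section \<open>The recursion at the maximal edge\<close>

lemma permutes_comp_transpose:
  assumes "w permutes V" "s \<in> V" "t \<in> V"
  shows "w \<circ> transpose s t permutes V"
  using assms by (simp add: permutes_compose permutes_swap_id)

lemma permutes_remove_fixed:
  assumes "w permutes V" "\<And>x. x \<in> A \<Longrightarrow> w x = x"
  shows "w permutes V - A"
  using assms by (auto intro: permutes_superset)

context maximal_edge
begin

lemma linked_recursion:
  assumes "w permutes verts G"
  shows "linked G w \<longleftrightarrow>
      linked (delete_edge G s t) w
    \<or> (\<exists>w'. w' permutes verts G - {t} \<and> w = expand s t w' \<and> linked (contract_edge G s t) w')
    \<or> (\<exists>w'. w' permutes verts G - {s, t} \<and> w = adjoin_swap s t w' \<and>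
          linked (extract_edge G s t) w')"
    (is "_ \<longleftrightarrow> ?D \<or> ?C \<or> ?E")
proof
  assume L: "linked G w"
  show "?D \<or> ?C \<or> ?E"
  proof (cases "inv w t = s")
    case False
    then show ?thesis using linked_delete[OF assms] L by blast
  next
    case True
    then have ws: "w s = t" using assms by (metis permutes_inv_eq)
    \<comment> \<open>As \<open>w s = t\<close>, this takes \<open>t\<close> out of its cycle. The
      result sends \<open>s\<close> to \<open>w t\<close>, so it fixes \<open>s\<close> exactly when
      \<open>w\<close> exchanges \<open>s\<close> and \<open>t\<close>.\<close>
    let ?w = "w \<circ> transpose s t"
    have p: "?w permutes verts G" using permutes_comp_transpose[OF assms s_in t_in] .
    have wt: "?w t = t" using ws by simp
    then have pt: "?w permutes verts G - {t}"
      using permutes_remove_fixed[OF p, of "{t}"] by auto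
    have e: "w = expand s t ?w" using wt by (simp add: expand_eq_comp comp_assoc)
    show ?thesis
    proof (cases "?w s = s")
      case False
      then show ?thesis using linked_contract[OF pt False] e L pt by metis
    next
      case fix_s: True
      have ps: "?w permutes verts G - {s, t}"
        by (rule permutes_remove_fixed[OF p]) (use fix_s wt in blast)
      have "w = adjoin_swap s t ?w" using e fix_s adjoin_swap_eq_expand by metis
      then show ?thesis using linked_extract[OF ps] L ps by metis
    qed
  qed
next
  assume "?D \<or> ?C \<or> ?E"
  then show "linked G w"
  proof (elim disjE exE conjE)
    assume "linked (delete_edge G s t) w"
    then show ?thesis by (auto simp: linked_def delete_edge_def adj_def)
  next
    fix w' assume w': "w' permutes verts G - {t}" "w = expand s t w'"
      "linked (contract_edge G s t) w'"
    have "ordered_graph (contract_edge G s t)"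
      using ordered_graph_contract[OF graph s_in s_neq] .
    then have "w' s \<noteq> s"
      using linked_no_fixpoint[of "contract_edge G s t" w' s] w' s_in s_neq
      by simp
    then show ?thesis using linked_contract w' by metis
  next
    fix w' assume w': "w' permutes verts G - {s, t}" "w = adjoin_swap s t w'"
      "linked (extract_edge G s t) w'"
    then show ?thesis using linked_extract by metis
  qed
qed

lemma adjoin_swap_permutes:
  assumes "w permutes verts G - {s, t}"
  shows "adjoin_swap s t w permutes verts G"
proof -
  have "w permutes verts G - {t}" "w s = s"
    using assms by (auto simp: permutes_not_in intro: permutes_subset)
  then show ?thesis using expand_permutes s_in t_in adjoin_swap_eq_expand by metis
qed

lemma linked_two_vertices:
  assumes V: "verts G = {s, t}" and w: "w permutes verts G"
  shows "linked G w \<longleftrightarrow> w = transpose s t"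
proof
  assume "linked G w"
  then have "inv w t = s"
    using linked_max[OF w] adj_verts V adj_irrefl[OF graph] by (metis insert_iff singletonD)
  then have "w s = t" using w by (metis permutes_inv_eq)
  moreover have "w \<in> {id, transpose s t}"
    using w V by (simp add: permutes_doubleton_iff)
  ultimately show "w = transpose s t" using s_neq by auto
next
  assume "w = transpose s t"
  \<comment> \<open>Extraction leaves no vertex here, so the condition for \<open>id\<close> is
    vacuous.\<close>
  then have "w = adjoin_swap s t id" by (auto simp: adjoin_swap_def transpose_def)
  then show "linked G w"
    using linked_extract[of id] V by (simp add: linked_def permutes_id)
qed

end

section \<open>Induction along the recursion\<close>

lemma maximal_edgeI:
  assumes G: "ordered_graph G" "verts G \<noteq> {}" "\<not> isolated G (max_vert G)"
  shows "maximal_edge G (max_nbr G) (max_vert G)"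
proof
  note fin = G(1)[unfolded ordered_graph_def, THEN conjunct1]
  show "ordered_graph G" "max_vert G \<in> verts G" using G max_vert_in by auto
  show "v \<le> max_vert G" if "v \<in> verts G" for v
    unfolding max_vert_def using fin that by simp
  show "adj G (max_nbr G) (max_vert G)" using max_nbr(2)[OF G(1,3)] by (simp add: adj_def)
  show "v \<le> max_nbr G" if "adj G v (max_vert G)" for v
  proof -
    have "v \<in> verts G" using that G(1) by (auto simp: adj_def ordered_graph_def)
    then show ?thesis unfolding max_nbr_def using fin that by (intro Max_ge) auto
  qed
qed

text \<open>An equality of sets that includes the permutation property: the induction must know that
  members for the smaller graphs permute the smaller vertex sets before \<open>t\<close> or the swap
  is inserted.\<close>

lemma DD_eq_linked:
  assumes "ordered_graph G" "verts G \<noteq> {}"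
  shows "DD G = {w. w permutes verts G \<and> linked G w}"
  using assms
proof (induction G rule: DD.induct)
  case (1 G)
  define t where "t = max_vert G"
  define s where "s = max_nbr G"
  note G = "1.prems"
  have fin: "finite (verts G)" using G by (simp add: ordered_graph_def)
  show ?case
  proof (cases "isolated G t")
    case True
    \<comment> \<open>At the maximal vertex the condition would make \<open>inv w t\<close> a
      neighbour of \<open>t\<close>.\<close>
    have "\<not> linked G w" if w: "w permutes verts G" for w
    proof
      assume L: "linked G w"
      have t: "t \<in> verts G" "\<And>v. v \<in> verts G \<Longrightarrow> v \<le> t"
        using G fin max_vert_in by (auto simp: t_def max_vert_def)
      then have "adj G (inv w t) t"
        using L rho_max[OF w fin] lambda_max[OF w] by (auto simp: linked_def)
      moreover have "inv w t \<in> verts G" using permutes_in_image[OF permutes_inv[OF w]] t by blast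
      ultimately show False using True by (auto simp: isolated_def)
    qed
    then show ?thesis using True G DD.simps[of G] by (auto simp: t_def)
  next
    case False
    interpret maximal_edge G s t
      unfolding s_def t_def using G False[unfolded t_def] by (rule maximal_edgeI)
    show ?thesis
    proof (cases "verts G = {s, t}")
      case True
      then have "DD G = {transpose s t}"
        using False G DD.simps[of G] by (simp add: s_def t_def)
      then show ?thesis
        using linked_two_vertices[OF True] permutes_swap_id[OF s_in t_in] by auto
    next
      case V: False
      note ne = verts_nonempty[OF G(1) False[unfolded t_def] G(2) V[unfolded s_def t_def],
          folded s_def t_def]
      have guard: "\<not> (\<not> ordered_graph G \<or> verts G = {})" using G by blast
      note IH = "1.IH"[OF guard False[unfolded t_def] t_def s_def V]
      have "DD G = DD (delete_edge G s t) \<union> expand s t ` DD (contract_edge G s t)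
          \<union> adjoin_swap s t ` DD (extract_edge G s t)"
        using False V G DD.simps[of G] by (simp add: s_def t_def Let_def)
      also have "DD (delete_edge G s t) = {w. w permutes verts G \<and> linked (delete_edge G s t) w}"
        using IH(1)[OF ordered_graph_delete[OF graph] ne(1)] by simp
      also have "DD (contract_edge G s t) =
          {w. w permutes verts G - {t} \<and> linked (contract_edge G s t) w}"
        using IH(2)[OF ordered_graph_contract[OF graph s_in s_neq] ne(2)] by simp
      also have "DD (extract_edge G s t) =
          {w. w permutes verts G - {s, t} \<and> linked (extract_edge G s t) w}"
        using IH(3)[OF ordered_graph_extract[OF graph] ne(3)] by simp
      finally have eq: "DD G = {w. w permutes verts G \<and> linked (delete_edge G s t) w}
          \<union> expand s t ` {w. w permutes verts G - {t} \<and> linked (contract_edge G s t) w}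
          \<union> adjoin_swap s t ` {w. w permutes verts G - {s, t} \<and> linked (extract_edge G s t) w}" .
      have "w permutes verts G" if "w \<in> DD G" for w
        using that expand_permutes[OF _ s_in t_in] adjoin_swap_permutes unfolding eq by auto
      moreover have "w \<in> DD G \<longleftrightarrow> linked G w" if "w permutes verts G" for w
        unfolding eq linked_recursion[OF that] using that by (simp add: image_iff) blast
      ultimately show ?thesis by blast
    qed
  qed
qed

theorem theorem3p11:
  fixes G :: "'a::linorder graph" and w :: "'a \<Rightarrow> 'a"
  assumes "ordered_graph G" and "verts G \<noteq> {}" and "w permutes verts G"
  shows "w \<in> DD G \<longleftrightarrow> (\<forall>t \<in> verts G. \<exists>v \<in> rho w t. adj G (lambda w t) v)"
  using DD_eq_linked[OF assms(1,2)] assms(3) by (simp add: linked_def)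

end
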